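(* For every integer $s\ge 1$, as $k\to\infty$, $$La([k]^2,\vee_s)=\Big(k_s+\frac{c_s}{k_s+1}+o(1)\Big)k.$$
   Context: $[k]^2$ is ordered coordinatewise. $\vee_s$ is the poset on $s+1$ elements $a,b_1,\dots,b_s$ whose only relations are $a<b_i$ for $i=1,\dots,s$. For posets $P,R$, $P$ is a weak subposet of $R$ if there is an injection $i:P\to R$ with $p\le_P p'\Rightarrow i(p)\le_R i(p')$; a subset $F\subseteq Q$ is weak $P$-free if $P$ is not a weak subposet of $F$ (with the induced order), and $La(Q,P)$ is the maximum size of a weak $P$-free subset of $Q$. For $s\ge1$, $k_s$ is the largest integer $k\ge1$ with $\sum_{j=2}^{k} j<s$ (empty sum $=0$), and $c_s=s-1-\sum_{j=2}^{k_s} j$. *)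

theory Defs
  imports Complex_Main
begin

definition weak_subposet ::
  "'a set \<Rightarrow> ('a \<Rightarrow> 'a \<Rightarrow> bool) \<Rightarrow> 'b set \<Rightarrow> ('b \<Rightarrow> 'b \<Rightarrow> bool) \<Rightarrow> bool" where
  "weak_subposet P leP R leR \<longleftrightarrow>
     (\<exists>i. inj_on i P \<and> i ` P \<subseteq> R \<and>
          (\<forall>p\<in>P. \<forall>p'\<in>P. leP p p' \<longrightarrow> leR (i p) (i p')))"

definition weak_free ::
  "'b set \<Rightarrow> ('b \<Rightarrow> 'b \<Rightarrow> bool) \<Rightarrow> 'a set \<Rightarrow> ('a \<Rightarrow> 'a \<Rightarrow> bool) \<Rightarrow> bool" where
  "weak_free F leQ P leP \<longleftrightarrow> \<not> weak_subposet P leP F leQ"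

definition La ::
  "'b set \<Rightarrow> ('b \<Rightarrow> 'b \<Rightarrow> bool) \<Rightarrow> 'a set \<Rightarrow> ('a \<Rightarrow> 'a \<Rightarrow> bool) \<Rightarrow> nat" where
  "La Q leQ P leP = Max {card F | F. F \<subseteq> Q \<and> weak_free F leQ P leP}"

definition grid :: "nat \<Rightarrow> (nat \<times> nat) set" where
  "grid k = {1..k} \<times> {1..k}"

definition grid_le :: "nat \<times> nat \<Rightarrow> nat \<times> nat \<Rightarrow> bool" where
  "grid_le x y \<longleftrightarrow> fst x \<le> fst y \<and> snd x \<le> snd y"

text \<open>The poset V_s: element 0 plays the role of a, elements 1..s the b_i.\<close>
definition vee :: "nat \<Rightarrow> nat set" where
  "vee s = {0..s}"

definition vee_le :: "nat \<Rightarrow> nat \<Rightarrow> bool" where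
  "vee_le x y \<longleftrightarrow> x = y \<or> (x = 0 \<and> 1 \<le> y)"

definition k_s :: "nat \<Rightarrow> nat" where
  "k_s s = (GREATEST k. k \<ge> 1 \<and> (\<Sum>j=2..k. j) < s)"

definition c_s :: "nat \<Rightarrow> nat" where
  "c_s s = s - 1 - (\<Sum>j=2..k_s s. j)"

end

theory Submission
  imports Defs
begin

text \<open>
  Write \<open>K\<close> for \<open>k_s s\<close> and \<open>c\<close> for \<open>c_s s\<close>, so that \<open>s = c + K(K+1)/2\<close>. A family is free of the
  poset iff each of its points lies below at most \<open>s\<close> points of the family (itself included).

  Lower bound: take \<open>K\<close> consecutive antidiagonals, and on the next one above keep \<open>c\<close> out of
  every \<open>K+1\<close> consecutive points; a point on the lowest antidiagonal then lies below
  \<open>1 + 2 + \<dots> + K + c = s\<close> points.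

  Upper bound: let \<open>Y i\<close> be the lowest height reached in the columns \<open>1, \<dots>, i\<close>. The points of the
  family above the corner \<open>(i, Y i)\<close> all lie above a single member of the family, so there are at
  most \<open>s\<close> of them; and of the points in column \<open>i + j\<close> at most \<open>Y i - Y (i + j)\<close> are not above
  this corner. Summing over \<open>0 \<le> j \<le> K\<close> and over all \<open>i\<close>, the differences telescope.
\<close>

section \<open>Freeness as a bound on the size of up-sets\<close>

definition upset :: "(nat \<times> nat) set \<Rightarrow> nat \<times> nat \<Rightarrow> (nat \<times> nat) set" where
  "upset F p = {q \<in> F. grid_le p q}"

text \<open>An up-set with more than \<open>s\<close> points contains \<open>p\<close> and
  \<open>s\<close> further points, which serve as images of \<open>0\<close> and of
  \<open>1, ..., s\<close>. Conversely, an embedded copy of \<open>vee s\<close> lies in the up-set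
  of the image of \<open>0\<close> and has \<open>s + 1\<close> points.\<close>

lemma weak_free_vee_iff:
  assumes "finite F"
  shows "weak_free F grid_le (vee s) vee_le \<longleftrightarrow> (\<forall>p\<in>F. card (upset F p) \<le> s)"
proof
  assume free: "weak_free F grid_le (vee s) vee_le"
  show "\<forall>p\<in>F. card (upset F p) \<le> s"
  proof (rule ballI, rule ccontr)
    fix p assume p: "p \<in> F" and "\<not> card (upset F p) \<le> s"
    moreover have fin: "finite (upset F p)" and pU: "p \<in> upset F p"
      using assms p by (auto simp: upset_def grid_le_def)
    ultimately have "s \<le> card (upset F p - {p})" by simp
    then obtain T where T: "T \<subseteq> upset F p - {p}" "card T = s" "finite T"
      by (meson obtain_subset_with_card_n)
    then obtain h where h: "bij_betw h {1..s} T"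
      using finite_same_card_bij[of "{1..s}" T] by auto
    define i where "i = h(0 := p)"
    have hT: "h j \<in> T" if "j \<in> {1..s}" for j
      using h that by (auto simp: bij_betw_def)
    have split: "vee s = insert 0 {1..s}" by (auto simp: vee_def)
    have "inj_on i {1..s}"
      using bij_betw_imp_inj_on[OF h] inj_on_cong[of "{1..s}" i h] by (simp add: i_def)
    moreover have "i 0 \<notin> i ` {1..s}"
    proof
      assume "i 0 \<in> i ` {1..s}"
      then obtain j where "j \<in> {1..s}" "p = h j" by (auto simp: i_def)
      then show False using hT[of j] T(1) by blast
    qed
    ultimately have "inj_on i (vee s)" by (auto simp: split)
    moreover have "i ` vee s \<subseteq> F"
    proof -
      have "T \<subseteq> F" using T(1) by (auto simp: upset_def)
      then show ?thesis using hT p by (auto simp: i_def split simp del: One_nat_def)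
    qed
    moreover have "grid_le (i a) (i b)" if "a \<in> vee s" "b \<in> vee s" "vee_le a b" for a b
    proof -
      have "grid_le p q" if "q \<in> T" for q using that T(1) by (auto simp: upset_def)
      then show ?thesis
        using that hT[of b] by (auto simp: vee_le_def i_def vee_def grid_le_def)
    qed
    ultimately have "weak_subposet (vee s) vee_le F grid_le"
      unfolding weak_subposet_def by (intro exI[of _ i] conjI ballI impI)
    then show False using free by (simp add: weak_free_def)
  qed
next
  assume small: "\<forall>p\<in>F. card (upset F p) \<le> s"
  show "weak_free F grid_le (vee s) vee_le"
    unfolding weak_free_def weak_subposet_def
  proof (rule notI, elim exE conjE)
    fix i assume i: "inj_on i (vee s)" "i ` vee s \<subseteq> F"
      "\<forall>p\<in>vee s. \<forall>p'\<in>vee s. vee_le p p' \<longrightarrow> grid_le (i p) (i p')"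
    have "grid_le (i 0) (i j)" if "j \<in> vee s" for j
    proof -
      have "0 \<in> vee s" "vee_le 0 j" by (auto simp: vee_def vee_le_def)
      then show ?thesis using i(3) that by blast
    qed
    then have "i ` vee s \<subseteq> upset F (i 0)"
      using i(2) unfolding upset_def by blast
    moreover have "finite (upset F (i 0))" using assms by (simp add: upset_def)
    ultimately have "card (i ` vee s) \<le> card (upset F (i 0))" by (rule card_mono[rotated])
    moreover have "card (i ` vee s) = s + 1" using i(1) by (simp add: card_image vee_def)
    moreover have "i 0 \<in> F" using i(2) by (auto simp: vee_def)
    ultimately show False using small by force
  qed
qed

section \<open>Arithmetic of \<open>k_s\<close> and \<open>c_s\<close>\<close>

lemma sum_from_2: "k \<ge> 1 \<Longrightarrow> 2 * (\<Sum>j=2..k. j) + 2 = k * (k + 1)" for k :: nat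
  by (induction k rule: dec_induct) auto

lemma k_s_c_s:
  assumes "s \<ge> 1"
  shows "k_s s \<ge> 1" "c_s s \<le> k_s s" "2 * s = 2 * c_s s + k_s s * (k_s s + 1)"
proof -
  define P where "P k \<longleftrightarrow> k \<ge> 1 \<and> (\<Sum>j=2..k. j) < s" for k :: nat
  \<comment> \<open>\<open>GREATEST\<close> yields a maximum only once the candidates are known to
    be bounded.\<close>
  have bound: "k \<le> s" if "P k" for k
  proof -
    have "2 * k \<le> k * (k + 1)" using that by (auto simp: P_def)
    then show ?thesis using that sum_from_2[of k] unfolding P_def by linarith
  qed
  have P1: "P 1" using assms by (simp add: P_def)
  have ks: "k_s s = Greatest P" unfolding k_s_def P_def by simp
  have PK: "P (k_s s)" unfolding ks by (rule GreatestI_nat[of P, OF P1 bound])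
  \<comment> \<open>Maximality means that the sum reaches \<open>s\<close> as soon as the summand
    \<open>k_s s + 1\<close> is added; this bounds \<open>c_s s\<close>.\<close>
  have notP: "\<not> P (k_s s + 1)"
    using Greatest_le_nat[of P "k_s s + 1" s] bound unfolding ks by fastforce
  show K: "k_s s \<ge> 1" using PK by (simp add: P_def)
  have "(\<Sum>j=2..k_s s + 1. j) = (\<Sum>j=2..k_s s. j) + (k_s s + 1)"
    using K by simp
  with notP PK show "c_s s \<le> k_s s" by (simp add: P_def c_s_def)
  show "2 * s = 2 * c_s s + k_s s * (k_s s + 1)"
    using PK sum_from_2[OF K] unfolding P_def c_s_def by linarith
qed

section \<open>Lower bound: full antidiagonals and a thinned one\<close>

lemma sum_Suc_lessThan: "2 * (\<Sum>l<K. Suc l) = K * (K + 1)" for K :: nat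
  by (induction K) auto

text \<open>Coordinate sum \<open>N + 1\<close> is the longest antidiagonal of the grid. The residue
  condition thins the last one, keeping \<open>c\<close> of any \<open>K + 1\<close> consecutive
  points when \<open>c \<le> K\<close>.\<close>

definition antidiagonals :: "nat \<Rightarrow> nat \<Rightarrow> nat \<Rightarrow> (nat \<times> nat) set" where
  "antidiagonals N K c = {p \<in> grid N. N + 1 \<le> fst p + snd p \<and>
     (fst p + snd p < N + 1 + K \<or> fst p + snd p = N + 1 + K \<and> fst p mod (K + 1) < c)}"

lemma mod_inj_on_window: "inj_on (\<lambda>x. x mod (K + 1)) {a..a + K}" for K a :: nat
proof (rule inj_onI)
  fix x y assume xy: "x \<in> {a..a + K}" "y \<in> {a..a + K}" "x mod (K + 1) = y mod (K + 1)"
  have *: "u = v" if "u \<le> v" "u \<in> {a..a + K}" "v \<in> {a..a + K}" "u mod (K + 1) = v mod (K + 1)"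
    for u v :: nat
  proof -
    have "(K + 1) dvd (v - u)" using that mod_eq_dvd_iff_nat[of u v "K + 1"] by simp
    moreover have "v - u < K + 1" using that by auto
    ultimately have "v - u = 0" using nat_dvd_not_less by blast
    then show ?thesis using that by simp
  qed
  show "x = y" using *[of x y] *[of y x] xy by (cases "x \<le> y") auto
qed

lemma card_upset_antidiagonals:
  assumes p: "p \<in> antidiagonals N K c"
  shows "card (upset (antidiagonals N K c) p) \<le> (\<Sum>l<K. Suc l) + c"
proof -
  let ?U = "upset (antidiagonals N K c) p"
  define U1 where "U1 = {q \<in> ?U. fst q + snd q < N + 1 + K}"
  define U2 where "U2 = {q \<in> ?U. fst q + snd q = N + 1 + K}"
  \<comment> \<open>A point is coded by its level \<open>l\<close> above the lowest antidiagonal and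
    its horizontal offset from \<open>p\<close>. As \<open>p\<close> has level at least 0, the
    offset is at most \<open>l\<close>.\<close>
  have "card U1 \<le> card (SIGMA l:{..<K}. {..l})"
  proof (rule card_inj_on_le)
    show "inj_on (\<lambda>q. (fst q + snd q - (N + 1), fst q - fst p)) U1"
      by (auto simp: inj_on_def U1_def upset_def antidiagonals_def grid_le_def)
    show "(\<lambda>q. (fst q + snd q - (N + 1), fst q - fst p)) ` U1 \<subseteq> (SIGMA l:{..<K}. {..l})"
      using p by (auto simp: U1_def upset_def antidiagonals_def grid_le_def)
  qed simp
  \<comment> \<open>On the thinned antidiagonal the points above \<open>p\<close> have first
    coordinates among \<open>K + 1\<close> consecutive integers, so their residues are distinct;
    only residues below \<open>c\<close> occur.\<close>
  moreover have "card U2 \<le> card {..<c}"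
  proof (rule card_inj_on_le)
    have window: "fst q \<in> {fst p..fst p + K}" if "q \<in> U2" for q
      using that p by (auto simp: U2_def upset_def antidiagonals_def grid_le_def)
    show "inj_on (\<lambda>q. fst q mod (K + 1)) U2"
    proof (rule inj_onI)
      fix q r assume qr: "q \<in> U2" "r \<in> U2" "fst q mod (K + 1) = fst r mod (K + 1)"
      then have "fst q = fst r"
        using window inj_onD[OF mod_inj_on_window[of K "fst p"]] by blast
      then show "q = r" using qr by (auto simp: U2_def prod_eq_iff)
    qed
    show "(\<lambda>q. fst q mod (K + 1)) ` U2 \<subseteq> {..<c}"
      by (auto simp: U2_def upset_def antidiagonals_def)
  qed simp
  moreover have "?U = U1 \<union> U2"
    by (auto simp: U1_def U2_def upset_def antidiagonals_def)
  ultimately show ?thesis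
    using card_Un_le[of U1 U2] by simp
qed

lemma finite_grid: "finite (grid N)"
  by (simp add: grid_def)

text \<open>\<open>A\<close> and \<open>B\<close> are explicit parts of the full antidiagonals and
  of the thinned one. Only columns beyond \<open>K\<close> are used, so that no height exceeds
  \<open>N\<close>; this costs a bounded number of points.\<close>

lemma card_antidiagonals:
  assumes "c \<le> K"
  shows "K * (N - K) + c * (N div (K + 1) - 1) \<le> card (antidiagonals N K c)"
proof -
  define A where "A = (\<lambda>(l, x). (x, N + 1 + l - x)) ` ({..<K} \<times> {K + 1..N})"
  define B where
    "B = (\<lambda>(r, q). ((K + 1) * q + r, N + 1 + K - ((K + 1) * q + r))) ` ({..<c} \<times> {1..<N div (K + 1)})"
  \<comment> \<open>Starting at \<open>q = 1\<close> skips the first block of columns, and stopping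
    before \<open>N div (K + 1)\<close> leaves only complete blocks.\<close>
  have rng: "K + 1 \<le> (K + 1) * q + r" "(K + 1) * q + r \<le> N"
    if "r < c" "1 \<le> q" "q < N div (K + 1)" for r q
  proof -
    have "(K + 1) * 1 \<le> (K + 1) * q" using that by (intro mult_le_mono) auto
    then show "K + 1 \<le> (K + 1) * q + r" by simp
    have "(K + 1) * (q + 1) \<le> (K + 1) * (N div (K + 1))" using that by (intro mult_le_mono) auto
    also have "\<dots> \<le> N" by (rule times_div_less_eq_dividend)
    finally show "(K + 1) * q + r \<le> N" using that assms by simp
  qed
  have modK: "((K + 1) * q + r) mod (K + 1) = r" if "r < c" for q r
    unfolding mod_mult_self4 using that assms by simp
  have "card A = K * (N - K)"
    unfolding A_def by (subst card_image) (auto simp: inj_on_def)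
  moreover have "card B = c * (N div (K + 1) - 1)"
  proof -
    have "inj_on (\<lambda>(r, q). ((K + 1) * q + r, N + 1 + K - ((K + 1) * q + r)))
        ({..<c} \<times> {1..<N div (K + 1)})"
    proof (rule inj_onI, clarify)
      fix r q r' q' assume *: "r < c" "r' < c" "(K + 1) * q + r = (K + 1) * q' + r'"
      have "((K + 1) * q + r) mod (K + 1) = r" "((K + 1) * q' + r') mod (K + 1) = r'"
        using *(1,2) by (blast intro: modK)+
      then have "r = r'" using *(3) by simp
      moreover from this have "(K + 1) * q = (K + 1) * q'" using *(3) by simp
      then have "q = q'" by (subst (asm) mult_cancel1) simp
      ultimately show "r = r' \<and> q = q'" by blast
    qed
    then show ?thesis unfolding B_def by (simp add: card_image)
  qed
  moreover have "A \<inter> B = {}"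
  proof -
    have "fst p + snd p < N + 1 + K" if "p \<in> A" for p
      using that by (auto simp: A_def)
    moreover have "fst p + snd p = N + 1 + K" if "p \<in> B" for p
      using that rng by (fastforce simp: B_def)
    ultimately show ?thesis by fastforce
  qed
  moreover have "A \<subseteq> antidiagonals N K c"
    by (auto simp: A_def antidiagonals_def grid_def)
  moreover have "B \<subseteq> antidiagonals N K c"
  proof
    fix p assume "p \<in> B"
    then obtain r q where rq: "r < c" "1 \<le> q" "q < N div (K + 1)"
      and p: "p = ((K + 1) * q + r, N + 1 + K - ((K + 1) * q + r))"
      by (auto simp: B_def)
    show "p \<in> antidiagonals N K c"
      using rng[OF rq] rq(1) modK[OF rq(1), of q] unfolding p antidiagonals_def grid_def by auto
  qed
  moreover have "finite (antidiagonals N K c)"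
    by (rule finite_subset[OF _ finite_grid[of N]]) (auto simp: antidiagonals_def)
  ultimately show ?thesis
    by (metis Un_least card_Un_disjoint card_mono finite_subset)
qed

section \<open>Upper bound: corners under the running minimum\<close>

text \<open>This is \<open>Y i\<close> of the overview. The default \<open>N + 1\<close> lies just
  above the grid, so that a corner with no member in the columns up to \<open>i\<close> has nothing
  above it.\<close>

definition running_min :: "nat \<Rightarrow> (nat \<times> nat) set \<Rightarrow> nat \<Rightarrow> nat" where
  "running_min N F i = Min (insert (N + 1) (snd ` {p \<in> F. fst p \<le> i}))"

lemma running_min:
  assumes "finite F"
  shows running_min_le: "running_min N F i \<le> N + 1"
    and running_min_le_snd: "p \<in> F \<Longrightarrow> fst p \<le> i \<Longrightarrow> running_min N F i \<le> snd p"
    and running_min_antimono: "i \<le> j \<Longrightarrow> running_min N F j \<le> running_min N F i"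
    and running_min_cases:
      "running_min N F i = N + 1 \<or> (\<exists>p\<in>F. fst p \<le> i \<and> snd p = running_min N F i)"
proof -
  have fin: "finite (insert (N + 1) (snd ` {p \<in> F. fst p \<le> i}))" for i
    using assms by simp
  show "running_min N F i \<le> N + 1" unfolding running_min_def by (rule Min_le[OF fin]) simp
  show "p \<in> F \<Longrightarrow> fst p \<le> i \<Longrightarrow> running_min N F i \<le> snd p"
    unfolding running_min_def by (rule Min_le[OF fin]) auto
  show "i \<le> j \<Longrightarrow> running_min N F j \<le> running_min N F i"
    unfolding running_min_def by (rule Min_antimono[OF _ _ fin]) auto
  show "running_min N F i = N + 1 \<or> (\<exists>p\<in>F. fst p \<le> i \<and> snd p = running_min N F i)"
    using Min_in[OF fin[of i]] unfolding running_min_def by auto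
qed

text \<open>The corner may lie outside \<open>F\<close>, but a member attaining the minimum,
  possibly in an earlier column, is below it, and its up-set contains everything above the
  corner.\<close>

lemma card_above_corner:
  assumes "F \<subseteq> grid N" and small: "\<forall>p\<in>F. card (upset F p) \<le> s"
  shows "card {p \<in> F. i \<le> fst p \<and> running_min N F i \<le> snd p} \<le> s"
proof -
  have fin: "finite F" using assms(1) finite_grid finite_subset by blast
  from running_min_cases[OF fin, of N i] show ?thesis
  proof
    assume "running_min N F i = N + 1"
    then have "{p \<in> F. i \<le> fst p \<and> running_min N F i \<le> snd p} = {}"
      using assms(1) by (auto simp: grid_def)
    then show ?thesis by (simp only: card.empty)
  next
    assume "\<exists>p\<in>F. fst p \<le> i \<and> snd p = running_min N F i"
    then obtain p where p: "p \<in> F" "fst p \<le> i" "snd p = running_min N F i" by blast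
    then have "{p \<in> F. i \<le> fst p \<and> running_min N F i \<le> snd p} \<subseteq> upset F p"
      by (auto simp: upset_def grid_le_def)
    then have "card {p \<in> F. i \<le> fst p \<and> running_min N F i \<le> snd p} \<le> card (upset F p)"
      using fin by (intro card_mono) (auto simp: upset_def)
    then show ?thesis using small p(1) le_trans by blast
  qed
qed

text \<open>Points of column \<open>i + j\<close> under the corner have heights from
  \<open>running_min N F (i + j)\<close> up to, but excluding, \<open>running_min N F i\<close>. The
  additive form avoids truncated subtraction.\<close>

lemma card_column_le:
  assumes fin: "finite F"
  shows "card {p \<in> F. fst p = i + j} + running_min N F (i + j) \<le>
    card {p \<in> F. fst p = i + j \<and> running_min N F i \<le> snd p} + running_min N F i"
proof -
  let ?Y = "running_min N F"
  let ?S = "{p \<in> F. fst p = i + j \<and> ?Y i \<le> snd p}"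
  have "{p \<in> F. fst p = i + j} \<subseteq> ?S \<union> {i + j} \<times> {?Y (i + j)..<?Y i}"
    using running_min_le_snd[OF fin, of _ "i + j"] by force
  then have "card {p \<in> F. fst p = i + j} \<le> card (?S \<union> {i + j} \<times> {?Y (i + j)..<?Y i})"
    using fin by (intro card_mono) auto
  also have "\<dots> \<le> card ?S + card ({i + j} \<times> {?Y (i + j)..<?Y i})" by (rule card_Un_le)
  also have "\<dots> = card ?S + (?Y i - ?Y (i + j))" by (simp add: card_cartesian_product)
  finally show ?thesis using running_min_antimono[OF fin, of i "i + j" N] by simp
qed

text \<open>The sets \<open>?S j\<close> lie in distinct columns and all above the same corner, so
  together they have at most \<open>s\<close> points.\<close>

lemma corner_inequality:
  assumes sub: "F \<subseteq> grid N" and small: "\<forall>p\<in>F. card (upset F p) \<le> s"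
  shows "(\<Sum>j\<le>m. card {p \<in> F. fst p = i + j} + running_min N F (i + j)) \<le>
    s + (m + 1) * running_min N F i"
proof -
  have fin: "finite F" using sub finite_grid finite_subset by blast
  let ?S = "\<lambda>j. {p \<in> F. fst p = i + j \<and> running_min N F i \<le> snd p}"
  have "(\<Sum>j\<le>m. card (?S j)) = card (\<Union>j\<le>m. ?S j)"
    using fin by (subst card_UN_disjoint) auto
  also have "\<dots> \<le> card {p \<in> F. i \<le> fst p \<and> running_min N F i \<le> snd p}"
    using fin by (intro card_mono) auto
  also have "\<dots> \<le> s" by (rule card_above_corner[OF sub small])
  finally have S: "(\<Sum>j\<le>m. card (?S j)) \<le> s" .
  have "(\<Sum>j\<le>m. card {p \<in> F. fst p = i + j} + running_min N F (i + j))
      \<le> (\<Sum>j\<le>m. card (?S j) + running_min N F i)"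
    by (intro sum_mono card_column_le fin)
  also have "\<dots> = (\<Sum>j\<le>m. card (?S j)) + (m + 1) * running_min N F i"
    by (simp add: sum.distrib)
  finally show ?thesis using S by linarith
qed

lemma card_eq_sum_columns:
  assumes "F \<subseteq> grid N"
  shows "card F = (\<Sum>i=1..N. card {p \<in> F. fst p = i})"
proof -
  have fin: "finite F" using assms finite_grid finite_subset by blast
  have "F = (\<Union>i\<in>{1..N}. {p \<in> F. fst p = i})" using assms by (auto simp: grid_def)
  then have "card F = card (\<Union>i\<in>{1..N}. {p \<in> F. fst p = i})" by simp
  also have "\<dots> = (\<Sum>i=1..N. card {p \<in> F. fst p = i})"
    using fin by (intro card_UN_disjoint) auto
  finally show ?thesis .
qed

text \<open>Each shift by one drops a single term, at most \<open>B\<close>, and gains a nonnegative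
  one.\<close>

lemma sum_shift_ge:
  fixes g :: "nat \<Rightarrow> nat"
  assumes "\<And>i. g i \<le> B"
  shows "(\<Sum>i=1..N. g i) \<le> (\<Sum>i=1..N. g (i + j)) + j * B"
proof (induction j)
  case (Suc j)
  have "(\<Sum>i=1..N. g (i + j)) \<le> (\<Sum>i=1..N. g (i + Suc j)) + B"
  proof (cases N)
    case (Suc n)
    have "(\<Sum>i=1..N. g (i + j)) = g (1 + j) + (\<Sum>i=Suc 1..Suc n. g (i + j))"
      unfolding Suc by (subst sum.atLeast_Suc_atMost) auto
    also have "(\<Sum>i=Suc 1..Suc n. g (i + j)) = (\<Sum>i=1..n. g (i + Suc j))"
      by (subst sum.shift_bounds_cl_Suc_ivl) simp
    finally show ?thesis using assms[of "1 + j"] by (simp add: Suc)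
  qed simp
  with Suc show ?case by simp
qed simp

text \<open>Sum \<open>corner_inequality\<close> over all \<open>i\<close>. Up to boundary terms the
  left side is \<open>m + 1\<close> copies of the sum of \<open>g\<close>, so the sums of
  \<open>?Y\<close> cancel and \<open>card F\<close> remains.\<close>

lemma card_free_le:
  assumes sub: "F \<subseteq> grid N" and small: "\<forall>p\<in>F. card (upset F p) \<le> s"
  shows "2 * (m + 1) * card F \<le> 2 * s * N + m * (m + 1) * (N + 1 + s)"
proof -
  have fin: "finite F" using sub finite_grid finite_subset by blast
  let ?Y = "running_min N F"
  let ?a = "\<lambda>i. card {p \<in> F. fst p = i}"
  \<comment> \<open>Every member in column \<open>i\<close> is above the corner of that
    column.\<close>
  have a_le: "?a i \<le> s" for i
    using fin running_min_le_snd[OF fin, of _ i N]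
    by (intro order_trans[OF card_mono card_above_corner[OF sub small, of i]]) auto
  define g where "g i = ?a i + ?Y i" for i
  have g: "g i \<le> N + 1 + s" for i
    using a_le[of i] running_min_le[OF fin, of N i] by (simp add: g_def)
  have "(m + 1) * (\<Sum>i=1..N. g i) = (\<Sum>j\<le>m. \<Sum>i=1..N. g i)" by simp
  also have "\<dots> \<le> (\<Sum>j\<le>m. (\<Sum>i=1..N. g (i + j)) + j * (N + 1 + s))"
    by (intro sum_mono sum_shift_ge g)
  also have "\<dots> = (\<Sum>i=1..N. \<Sum>j\<le>m. g (i + j)) + (\<Sum>j\<le>m. j) * (N + 1 + s)"
    by (simp only: sum.distrib sum_distrib_right sum.swap[of _ "{..m}"])
  also have "(\<Sum>i=1..N. \<Sum>j\<le>m. g (i + j)) \<le> (\<Sum>i=1..N. s + (m + 1) * ?Y i)"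
    unfolding g_def by (intro sum_mono corner_inequality sub small)
  also have "\<dots> = s * N + (m + 1) * (\<Sum>i=1..N. ?Y i)"
    by (simp only: sum.distrib sum_distrib_left) simp
  finally have "(m + 1) * (\<Sum>i=1..N. g i)
      \<le> s * N + (m + 1) * (\<Sum>i=1..N. ?Y i) + (\<Sum>j\<le>m. j) * (N + 1 + s)" by simp
  moreover have "(\<Sum>i=1..N. g i) = card F + (\<Sum>i=1..N. ?Y i)"
    by (simp add: g_def sum.distrib card_eq_sum_columns[OF sub])
  ultimately have "(m + 1) * card F \<le> s * N + (\<Sum>j\<le>m. j) * (N + 1 + s)"
    by (simp add: distrib_left)
  then have "2 * ((m + 1) * card F) \<le> 2 * (s * N) + 2 * (\<Sum>j\<le>m. j) * (N + 1 + s)"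
    by linarith
  moreover have "2 * (\<Sum>j\<le>m. j) = m * (m + 1)" by (induction m) auto
  ultimately show ?thesis by (simp only: mult.assoc)
qed

section \<open>The extremal number and its limit\<close>

lemma La_grid_vee:
  shows La_grid_vee_attained: "\<exists>F. F \<subseteq> grid N \<and> (\<forall>p\<in>F. card (upset F p) \<le> s) \<and>
      card F = La (grid N) grid_le (vee s) vee_le"
    and La_grid_vee_ge: "G \<subseteq> grid N \<Longrightarrow> \<forall>p\<in>G. card (upset G p) \<le> s \<Longrightarrow>
      card G \<le> La (grid N) grid_le (vee s) vee_le"
proof -
  have "weak_free F grid_le (vee s) vee_le \<longleftrightarrow> (\<forall>p\<in>F. card (upset F p) \<le> s)"
    if "F \<subseteq> grid N" for F
    using that finite_grid finite_subset by (intro weak_free_vee_iff) blast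
  then have eq: "{card F |F. F \<subseteq> grid N \<and> weak_free F grid_le (vee s) vee_le} =
      card ` {F \<in> Pow (grid N). \<forall>p\<in>F. card (upset F p) \<le> s}" (is "_ = ?C")
    by auto
  have fin: "finite ?C" by (simp add: finite_grid)
  \<comment> \<open>The empty family shows that the maximum is over a nonempty set.\<close>
  have "card ({} :: (nat \<times> nat) set) \<in> ?C" by (rule imageI) simp
  then have "Max ?C \<in> ?C" using fin by (intro Max_in) auto
  then show "\<exists>F. F \<subseteq> grid N \<and> (\<forall>p\<in>F. card (upset F p) \<le> s) \<and>
      card F = La (grid N) grid_le (vee s) vee_le"
    unfolding La_def eq by force
  show "G \<subseteq> grid N \<Longrightarrow> \<forall>p\<in>G. card (upset G p) \<le> s \<Longrightarrow>
      card G \<le> La (grid N) grid_le (vee s) vee_le"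
    unfolding La_def eq by (rule Max_ge[OF fin]) auto
qed

theorem theorem1p5:
  fixes s :: nat
  assumes "s \<ge> 1"
  shows "(\<lambda>k. real (La (grid k) grid_le (vee s) vee_le) / real k)
           \<longlonglongrightarrow> real (k_s s) + real (c_s s) / real (k_s s + 1)"
proof -
  define K c where "K = k_s s" and "c = c_s s"
  have c: "c \<le> K" and s: "2 * s = 2 * c + K * (K + 1)"
    using k_s_c_s[OF assms] by (simp_all add: K_def c_def)
  define L where "L = real K + real c / real (K + 1)"
  define La' where "La' N = La (grid N) grid_le (vee s) vee_le" for N
  \<comment> \<open>\<open>U\<close> is what remains of the boundary terms in
    \<open>card_free_le\<close> for \<open>m = K\<close>, after division by
    \<open>2 * (K + 1)\<close>. In \<open>D\<close>, the square comes from the \<open>K\<close>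
    skipped columns, and \<open>2 * c\<close> from the skipped first block and the rounding in
    \<open>N div (K + 1)\<close>.\<close>
  define U where "U = real K * (1 + real s) / 2"
  define D where "D = (real K)\<^sup>2 + 2 * real c"
  have upper: "real (La' N) \<le> L * real N + U" for N
  proof -
    obtain F where F: "F \<subseteq> grid N" "\<forall>p\<in>F. card (upset F p) \<le> s" "card F = La' N"
      using La_grid_vee_attained[of N s] unfolding La'_def by (elim exE conjE)
    have "2 * (K + 1) * La' N \<le> (2 * c + K * (K + 1)) * N + K * (K + 1) * (N + 1 + s)"
      using card_free_le[OF F(1,2), of K] unfolding F(3) s .
    then have "2 * (real K + 1) * real (La' N) \<le>
        (2 * real c + real K * (real K + 1)) * real N + real K * (real K + 1) * (real N + 1 + real s)"
      unfolding of_nat_le_iff[where 'a = real, symmetric] by (simp add: algebra_simps)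
    also have "\<dots> = 2 * (real K + 1) * (L * real N + U)"
      by (simp add: L_def U_def field_simps)
    finally show ?thesis by (simp add: mult_le_cancel_left)
  qed
  have lower: "L * real N - D \<le> real (La' N)" for N
  proof -
    have "(\<Sum>l<K. Suc l) + c = s" using sum_Suc_lessThan[of K] s by linarith
    then have "card (antidiagonals N K c) \<le> La' N"
      unfolding La'_def using card_upset_antidiagonals[of _ N K c]
      by (intro La_grid_vee_ge) (auto simp: antidiagonals_def)
    then have *: "K * (N - K) + c * (N div (K + 1) - 1) \<le> La' N"
      using card_antidiagonals[OF c, of N] by linarith
    have "real N / real (K + 1) < real (N div (K + 1)) + 1"
    proof -
      have "N < (K + 1) * (N div (K + 1) + 1)"
        using dividend_less_times_div[of "K + 1" N] by simp
      then have "real N < real (K + 1) * (real (N div (K + 1)) + 1)"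
        by (metis of_nat_1 of_nat_add of_nat_less_iff of_nat_mult)
      then show ?thesis by (simp add: pos_divide_less_eq mult.commute)
    qed
    then have "real c * (real N / real (K + 1) - 2) \<le> real c * real (N div (K + 1) - 1)"
      by (intro mult_left_mono) linarith+
    moreover have "real K * (real N - real K) \<le> real K * real (N - K)"
      by (intro mult_left_mono) linarith+
    moreover have "real K * real (N - K) + real c * real (N div (K + 1) - 1) \<le> real (La' N)"
      using * by (metis of_nat_add of_nat_le_iff of_nat_mult)
    moreover have "L * real N - D = real K * (real N - real K) + real c * (real N / real (K + 1) - 2)"
      by (simp add: L_def D_def algebra_simps power2_eq_square)
    ultimately show ?thesis by linarith
  qed
  have "(\<lambda>N. real (La' N) / real N) \<longlonglongrightarrow> L"
  proof (rule tendsto_sandwich)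
    show "\<forall>\<^sub>F N in sequentially. L - D / real N \<le> real (La' N) / real N"
      using eventually_gt_at_top[of 0]
    proof eventually_elim
      case (elim N)
      then have "L - D / real N = (L * real N - D) / real N" by (simp add: diff_divide_distrib)
      then show ?case using lower[of N] by (simp add: divide_right_mono)
    qed
    show "\<forall>\<^sub>F N in sequentially. real (La' N) / real N \<le> L + U / real N"
      using eventually_gt_at_top[of 0]
    proof eventually_elim
      case (elim N)
      then have "L + U / real N = (L * real N + U) / real N" by (simp add: add_divide_distrib)
      then show ?case using upper[of N] by (simp add: divide_right_mono)
    qed
    show "(\<lambda>N. L - D / real N) \<longlonglongrightarrow> L"
      using tendsto_diff[OF tendsto_const lim_const_over_n[of D], of L] by simp
    show "(\<lambda>N. L + U / real N) \<longlonglongrightarrow> L"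
      using tendsto_add[OF tendsto_const lim_const_over_n[of U], of L] by simp
  qed
  then show ?thesis unfolding La'_def L_def K_def c_def .
qed

end
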